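(* Let $R$ be a ring, and suppose that there exists $r\in R$ such that the inner derivation $\mathrm{ad}_r:R\to R$, $\mathrm{ad}_r(s)=rs-sr$, is surjective. Then: (a) The matrix ring $R_3$ is a sum of three nilpotent subrings of nilpotency index $3$, i.e. there are nilpotent subrings $S_1,S_2,S_3$ of $R_3$, each of nilpotency index $3$, such that $R_3=S_1+S_2+S_3$. (b) There exist three braceable subtrusses $K,L,M$ of the truss $T(R_3)$ such that $R_3=[K,L,M]$.
   Context: All rings are unital and associative, but subrings are not required to contain the identity. $R_3$ is the ring of $3\times 3$ matrices over $R$. A subring $S$ of a ring is nilpotent of nilpotency index $k$ if $S^k=0$ but $S^{k-1}\neq 0$. A truss is a triple $(T,[-,-,-],\cdot)$, where $[-,-,-]$ is a ternary operation on the set $T$ for which there exists an abelian group structure $(T,+)$ with $[x,y,z]=x-y+z$ for all $x,y,z\in T$, and $\cdot$ is an associative binary operation on $T$ that distributes over $[-,-,-]$ on both sides: $w\cdot[x,y,z]=[w\cdot x,w\cdot y,w\cdot z]$ and $[x,y,z]\cdot w=[x\cdot w,y\cdot w,z\cdot w]$. A subtruss of $T$ is a subset $S\subseteq T$ closed under the operations $[-,-,-]$ and $\cdot$. A truss is braceable if $(T,\cdot)$ is a group; a braceable subtruss is a subtruss that is braceable as a truss. To every ring $(Q,+,\cdot)$ one associates the truss $T(Q)=(Q,[-,-,-],\cdot)$ with $[x,y,z]=x-y+z$. For subsets $X,Y,Z$ of a truss, $[X,Y,Z]=\{[x,y,z]\mid x\in X,\ y\in Y,\ z\in Z\}$. 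*)

theory Defs
  imports "HOL-Algebra.AbelCoset" "HOL-Algebra.Generated_Groups" "Jordan_Normal_Form.Matrix"
begin

definition inner_derivation :: "'a::ring_1 \<Rightarrow> 'a \<Rightarrow> 'a" where
  "inner_derivation r s = r * s - s * r"

text \<open>The library proves that \<open>ring_mat\<close> is a ring only over commutative rings.\<close>

lemma ring_mat_noncomm: "ring (ring_mat TYPE('a::ring_1) n b)"
proof -
  interpret semiring "ring_mat TYPE('a) n b" by (rule semiring_mat)
  have "\<exists>B\<in>carrier_mat n n. B + A = 0\<^sub>m n n"
    if "A \<in> carrier_mat n n" for A :: "'a mat"
    using that by (intro bexI[of _ "- A"]) auto
  then have "abelian_group (ring_mat TYPE('a) n b)"
    by (intro abelian_groupI a_closed zero_closed a_assoc a_comm l_zero) (simp_all add: ring_mat_simps)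
  then show ?thesis
    by (intro ringI monoid_axioms l_distr r_distr)
qed


subsection \<open>Nilpotent subrings\<close>

text \<open>Unlike \<open>subring\<close> in HOL-Algebra, these need not contain the identity.\<close>

definition nonunital_subring :: "('a, 'b) ring_scheme \<Rightarrow> 'a set \<Rightarrow> bool" where
  "nonunital_subring Q S \<longleftrightarrow>
     additive_subgroup S Q \<and> (\<forall>x\<in>S. \<forall>y\<in>S. x \<otimes>\<^bsub>Q\<^esub> y \<in> S)"

text \<open>\<open>S\<^sup>k\<close> is the additive subgroup generated by all products of \<open>k\<close> elements of \<open>S\<close>.
  In particular \<open>S\<^sup>0\<close> is generated by the identity of \<open>Q\<close>.\<close>

definition set_power :: "('a, 'b) ring_scheme \<Rightarrow> 'a set \<Rightarrow> nat \<Rightarrow> 'a set" where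
  "set_power Q S k =
     generate (add_monoid Q) {foldr (\<otimes>\<^bsub>Q\<^esub>) xs \<one>\<^bsub>Q\<^esub> | xs. length xs = k \<and> set xs \<subseteq> S}"

definition nilpotent_subring_of_index :: "('a, 'b) ring_scheme \<Rightarrow> 'a set \<Rightarrow> nat \<Rightarrow> bool" where
  "nilpotent_subring_of_index Q S k \<longleftrightarrow>
     nonunital_subring Q S \<and> set_power Q S k = {\<zero>\<^bsub>Q\<^esub>} \<and> set_power Q S (k - 1) \<noteq> {\<zero>\<^bsub>Q\<^esub>}"


subsection \<open>Trusses\<close>

record 'a truss = "'a partial_object" +
  bracket :: "'a \<Rightarrow> 'a \<Rightarrow> 'a \<Rightarrow> 'a"
  tmult :: "'a \<Rightarrow> 'a \<Rightarrow> 'a"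

text \<open>The abelian group \<open>G\<close> below is written multiplicatively, as always in HOL-Algebra.\<close>

locale truss =
  fixes T :: "('a, 'b) truss_scheme"
  assumes bracket_group:
      "\<exists>G :: 'a monoid. comm_group G \<and> carrier G = carrier T \<and>
         (\<forall>x\<in>carrier T. \<forall>y\<in>carrier T. \<forall>z\<in>carrier T.
            bracket T x y z = x \<otimes>\<^bsub>G\<^esub> inv\<^bsub>G\<^esub> y \<otimes>\<^bsub>G\<^esub> z)"
    and tmult_closed:
      "\<lbrakk>x \<in> carrier T; y \<in> carrier T\<rbrakk> \<Longrightarrow> tmult T x y \<in> carrier T"
    and tmult_assoc:
      "\<lbrakk>x \<in> carrier T; y \<in> carrier T; z \<in> carrier T\<rbrakk>
        \<Longrightarrow> tmult T (tmult T x y) z = tmult T x (tmult T y z)"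
    and distrib_left:
      "\<lbrakk>w \<in> carrier T; x \<in> carrier T; y \<in> carrier T; z \<in> carrier T\<rbrakk>
        \<Longrightarrow> tmult T w (bracket T x y z) = bracket T (tmult T w x) (tmult T w y) (tmult T w z)"
    and distrib_right:
      "\<lbrakk>w \<in> carrier T; x \<in> carrier T; y \<in> carrier T; z \<in> carrier T\<rbrakk>
        \<Longrightarrow> tmult T (bracket T x y z) w = bracket T (tmult T x w) (tmult T y w) (tmult T z w)"

definition subtruss :: "('a, 'b) truss_scheme \<Rightarrow> 'a set \<Rightarrow> bool" where
  "subtruss T S \<longleftrightarrow> S \<subseteq> carrier T \<and>
     (\<forall>x\<in>S. \<forall>y\<in>S. \<forall>z\<in>S. bracket T x y z \<in> S) \<and>
     (\<forall>x\<in>S. \<forall>y\<in>S. tmult T x y \<in> S)"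

definition braceable :: "('a, 'b) truss_scheme \<Rightarrow> bool" where
  "braceable T \<longleftrightarrow> truss T \<and>
     (\<exists>e. group \<lparr>carrier = carrier T, monoid.mult = tmult T, one = e\<rparr>)"

definition braceable_subtruss :: "('a, 'b) truss_scheme \<Rightarrow> 'a set \<Rightarrow> bool" where
  "braceable_subtruss T S \<longleftrightarrow> subtruss T S \<and> braceable (T\<lparr>carrier := S\<rparr>)"

definition bracket_set :: "('a, 'b) truss_scheme \<Rightarrow> 'a set \<Rightarrow> 'a set \<Rightarrow> 'a set \<Rightarrow> 'a set" where
  "bracket_set T X Y Z = {bracket T x y z | x y z. x \<in> X \<and> y \<in> Y \<and> z \<in> Z}"

definition truss_of_ring :: "('a, 'b) ring_scheme \<Rightarrow> 'a truss" where
  "truss_of_ring Q =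
     \<lparr>carrier = carrier Q, bracket = (\<lambda>x y z. (x \<ominus>\<^bsub>Q\<^esub> y) \<oplus>\<^bsub>Q\<^esub> z), tmult = (\<otimes>\<^bsub>Q\<^esub>)\<rparr>"

lemma truss_truss_of_ring:
  assumes "ring Q"
  shows "truss (truss_of_ring Q)"
proof -
  interpret ring Q by fact
  define G where "G = \<lparr>carrier = carrier Q, monoid.mult = add Q, one = \<zero>\<^bsub>Q\<^esub>\<rparr>"
  have G: "comm_group G"
    unfolding G_def
    by (rule comm_groupI) (auto simp: a_assoc intro: a_comm bexI[of _ "\<ominus>\<^bsub>Q\<^esub> x" for x] l_neg)
  have inv: "inv\<^bsub>G\<^esub> y = \<ominus>\<^bsub>Q\<^esub> y" if "y \<in> carrier Q" for y
    by (rule group.inv_equality[OF comm_group.axioms(2)[OF G]]) (use that in \<open>auto simp: G_def l_neg\<close>)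
  show ?thesis
    unfolding truss_def truss_of_ring_def truss.simps partial_object.simps
  proof (intro conjI allI impI exI[of _ G] ballI)
    show "comm_group G" by (rule G)
    show "carrier G = carrier Q" by (simp add: G_def)
    show "(x \<ominus>\<^bsub>Q\<^esub> y) \<oplus>\<^bsub>Q\<^esub> z = x \<otimes>\<^bsub>G\<^esub> inv\<^bsub>G\<^esub> y \<otimes>\<^bsub>G\<^esub> z"
      if "x \<in> carrier Q" "y \<in> carrier Q" "z \<in> carrier Q" for x y z
      using that by (simp only: inv) (simp add: G_def a_minus_def)
  qed (simp_all add: a_minus_def m_assoc l_distr r_distr l_minus r_minus)
qed

end

theory Submission
  imports Defs
begin

text \<open>Strictly upper and strictly lower triangular \<open>3 \<times> 3\<close> matrices form nilpotent subrings of
  index three whose sum is the set of all matrices with zero diagonal. A third nilpotent subring is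
  therefore enough as soon as its elements take all values on the diagonal. Over a commutative ring
  no nilpotent subring can do this for trace reasons; over a noncommutative ring the trace of a
  nilpotent matrix can still be a nonzero commutator, and if \<open>ad\<^sub>r\<close> is surjective then every element
  of the ring is a commutator \<open>r y - y r\<close>.

  The third subring is the conjugate \<open>g U g\<^sup>-\<^sup>1\<close> of the ring \<open>U\<close> of strictly upper triangular
  matrices, with \<open>g\<close> unipotent lower triangular with entries \<open>1, r, 1\<close> below the diagonal. If \<open>n \<in> U\<close>
  has the entries \<open>x, y\<close> in its first row and \<open>z\<close> in its second, the diagonal of \<open>g n g\<^sup>-\<^sup>1\<close> is
  \<open>(y (1 - r) - x, x - y - z, r y + z)\<close>. The sum of the three entries is \<open>r y - y r\<close>, so \<open>y\<close> can be
  chosen to make the trace right; then \<open>x\<close> and \<open>z\<close> adjust the first and the last entry, and the middle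
  one follows. This is \<open>mat3_eq_sum_of_conjugates\<close>. The lower triangular matrices are also
  a conjugate of \<open>U\<close>, by the antidiagonal permutation matrix, so that nilpotency has to be checked for
  \<open>U\<close> alone.

  The statement on trusses holds for the same reason. If \<open>S\<close> is a nilpotent subring, then \<open>1 + S\<close> is
  a multiplicative group, because \<open>1 + x\<close> is inverted by the finite geometric series, and it is closed
  under \<open>x - y + z\<close>, because the coefficients \<open>1, -1, 1\<close> have sum one (\<open>braceable_subtruss_one_plus\<close>).
  In \<open>[1 + S\<^sub>1, 1 + S\<^sub>2, 1 + S\<^sub>3]\<close> the identities combine to a single one, which gives the translate by
  \<open>1\<close> of \<open>S\<^sub>1 + S\<^sub>2 + S\<^sub>3\<close>, that is, the whole ring (\<open>bracket_set_one_plus\<close>).\<close>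

section \<open>Nilpotent subrings of index three\<close>

context ring
begin

text \<open>An additive subgroup vanishes exactly when its generators do, so that nilpotency is a statement
  about products of elements only.\<close>

lemma set_power_eq_zero_iff:
  "set_power R S k = {\<zero>} \<longleftrightarrow>
    (\<forall>xs. length xs = k \<and> set xs \<subseteq> S \<longrightarrow> foldr (\<otimes>) xs \<one> = \<zero>)"
proof -
  define P where "P = {foldr (\<otimes>) xs \<one> | xs. length xs = k \<and> set xs \<subseteq> S}"
  have "generate (add_monoid R) P = {\<zero>} \<longleftrightarrow> P \<subseteq> {\<zero>}"
  proof
    assume "generate (add_monoid R) P = {\<zero>}"
    then show "P \<subseteq> {\<zero>}" using generate.incl[of _ P "add_monoid R"] by auto
  next
    assume "P \<subseteq> {\<zero>}"
    then have "generate (add_monoid R) P \<subseteq> generate (add_monoid R) {\<zero>}"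
      by (rule group.mono_generate[OF a_group])
    moreover have "generate (add_monoid R) {\<zero>} = {\<zero>}"
      using group.generate_one[OF a_group] by simp
    moreover have "\<zero> \<in> generate (add_monoid R) P"
      using generate.one[of "add_monoid R" P] by simp
    ultimately show "generate (add_monoid R) P = {\<zero>}" by blast
  qed
  then show ?thesis unfolding set_power_def P_def by blast
qed

lemma nilpotent_subring_of_index_3_iff:
  "nilpotent_subring_of_index R S 3 \<longleftrightarrow> nonunital_subring R S \<and>
    (\<forall>x\<in>S. \<forall>y\<in>S. \<forall>z\<in>S. x \<otimes> y \<otimes> z = \<zero>) \<and> (\<exists>x\<in>S. \<exists>y\<in>S. x \<otimes> y \<noteq> \<zero>)"
proof (cases "nonunital_subring R S")
  case True
  then have "additive_subgroup S R" by (simp add: nonunital_subring_def)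
  then have sub: "S \<subseteq> carrier R" by (rule additive_subgroup.a_subset)
  have 3: "(\<forall>xs. length xs = 3 \<and> set xs \<subseteq> S \<longrightarrow> foldr (\<otimes>) xs \<one> = \<zero>) \<longleftrightarrow>
      (\<forall>x\<in>S. \<forall>y\<in>S. \<forall>z\<in>S. x \<otimes> y \<otimes> z = \<zero>)" (is "?l \<longleftrightarrow> ?r")
  proof
    assume ?l
    then have "foldr (\<otimes>) [x, y, z] \<one> = \<zero>" if "x \<in> S" "y \<in> S" "z \<in> S" for x y z
      using that by (metis (no_types, lifting) bot.extremum insert_subset length_Cons list.set list.size(3)
          numeral_3_eq_3)
    then show ?r using sub by (auto simp: m_assoc subset_iff)
  next
    assume ?r
    then show ?l using sub by (auto simp: numeral_3_eq_3 length_Suc_conv m_assoc subset_iff)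
  qed
  have 2: "(\<forall>xs. length xs = 2 \<and> set xs \<subseteq> S \<longrightarrow> foldr (\<otimes>) xs \<one> = \<zero>) \<longleftrightarrow>
      (\<forall>x\<in>S. \<forall>y\<in>S. x \<otimes> y = \<zero>)" (is "?l \<longleftrightarrow> ?r")
  proof
    assume ?l
    then have "foldr (\<otimes>) [x, y] \<one> = \<zero>" if "x \<in> S" "y \<in> S" for x y
      using that by (metis (no_types, lifting) bot.extremum insert_subset length_Cons list.set list.size(3)
          numeral_2_eq_2)
    then show ?r using sub by (auto simp: subset_iff)
  next
    assume ?r
    then show ?l using sub by (auto simp: numeral_2_eq_2 length_Suc_conv subset_iff)
  qed
  show ?thesis
    unfolding nilpotent_subring_of_index_def set_power_eq_zero_iff
    using 2 3 by simp
qed (simp add: nilpotent_subring_of_index_def)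

lemma nilpotent_subring_of_index_3_conjugate:
  assumes S: "nilpotent_subring_of_index R S 3"
    and g: "g \<in> carrier R" "h \<in> carrier R" "g \<otimes> h = \<one>" "h \<otimes> g = \<one>"
  shows "nilpotent_subring_of_index R ((\<lambda>n. g \<otimes> n \<otimes> h) ` S) 3"
proof -
  define c where "c n = g \<otimes> n \<otimes> h" for n
  have add: "additive_subgroup S R" and mult: "\<And>x y. x \<in> S \<Longrightarrow> y \<in> S \<Longrightarrow> x \<otimes> y \<in> S"
    and cube: "\<And>x y z. x \<in> S \<Longrightarrow> y \<in> S \<Longrightarrow> z \<in> S \<Longrightarrow> x \<otimes> y \<otimes> z = \<zero>"
    and "\<exists>x\<in>S. \<exists>y\<in>S. x \<otimes> y \<noteq> \<zero>"
    using S unfolding nilpotent_subring_of_index_3_iff nonunital_subring_def by blast+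
  then obtain a b where ab: "a \<in> S" "b \<in> S" "a \<otimes> b \<noteq> \<zero>" by blast
  have sub: "x \<in> carrier R" if "x \<in> S" for x
    using additive_subgroup.a_subset[OF add] that by blast
  have c_closed: "c x \<in> carrier R" if "x \<in> carrier R" for x
    using that g by (simp add: c_def)
  have c_zero: "c \<zero> = \<zero>" using g by (simp add: c_def)
  \<comment> \<open>Conjugation is multiplicative and injective, so it carries over both the vanishing of triple
    products and a nonzero product of two elements.\<close>
  have c_mult: "c x \<otimes> c y = c (x \<otimes> y)" if "x \<in> carrier R" "y \<in> carrier R" for x y
  proof -
    have "c x \<otimes> c y = g \<otimes> x \<otimes> (h \<otimes> g) \<otimes> y \<otimes> h"
      using that g(1,2) by (simp add: c_def m_assoc)
    also have "\<dots> = c (x \<otimes> y)"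
      using that g by (simp add: c_def m_assoc)
    finally show ?thesis .
  qed
  have c_eq_zero: "x = \<zero>" if "c x = \<zero>" "x \<in> carrier R" for x
  proof -
    have "x = (h \<otimes> g) \<otimes> x \<otimes> (h \<otimes> g)" using that g by simp
    also have "\<dots> = h \<otimes> c x \<otimes> g" using that(2) g(1,2) by (simp add: c_def m_assoc)
    finally show ?thesis using that g by simp
  qed
  have "additive_subgroup (c ` S) R"
  proof (intro additive_subgroupI subgroup.intro)
    show "c ` S \<subseteq> carrier (add_monoid R)" using c_closed sub by auto
    show "\<one>\<^bsub>add_monoid R\<^esub> \<in> c ` S"
      using c_zero additive_subgroup.zero_closed[OF add] by force
  next
    fix x y assume "x \<in> c ` S" "y \<in> c ` S"
    then obtain u v where uv: "x = c u" "y = c v" "u \<in> S" "v \<in> S" by blast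
    then have "x \<oplus> y = c (u \<oplus> v)"
      using sub g(1,2) by (simp add: c_def l_distr r_distr)
    then show "x \<otimes>\<^bsub>add_monoid R\<^esub> y \<in> c ` S"
      using uv additive_subgroup.a_closed[OF add] by simp
  next
    fix x assume "x \<in> c ` S"
    then obtain u where u: "x = c u" "u \<in> S" by blast
    then have "\<ominus> x = c (\<ominus> u)"
      using sub g(1,2) by (simp add: c_def l_minus r_minus)
    moreover have "\<ominus> u \<in> S" using additive_subgroup.a_inv_closed[OF add] u by blast
    ultimately show "inv\<^bsub>add_monoid R\<^esub> x \<in> c ` S"
      by (auto simp: a_inv_def)
  qed
  moreover have "x \<otimes> y \<in> c ` S" if "x \<in> c ` S" "y \<in> c ` S" for x y
    using that c_mult sub mult by auto
  moreover have "x \<otimes> y \<otimes> z = \<zero>" if "x \<in> c ` S" "y \<in> c ` S" "z \<in> c ` S" for x y z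
    using that c_mult sub cube c_zero by auto
  moreover have "\<exists>x\<in>c ` S. \<exists>y\<in>c ` S. x \<otimes> y \<noteq> \<zero>"
    using ab c_mult sub c_eq_zero by (intro bexI[of _ "c a"] bexI[of _ "c b"]) auto
  ultimately show ?thesis
    unfolding nilpotent_subring_of_index_3_iff nonunital_subring_def c_def[abs_def] by blast
qed

end


section \<open>Braceable subtrusses\<close>

text \<open>Any element \<open>e\<close> of a subtruss can serve as the neutral element of an abelian group on it, with
  addition \<open>[x, e, y]\<close>. In terms of a group \<open>G\<close> on the whole truss this is the translation of \<open>G\<close> that
  moves its neutral element to \<open>e\<close>, and translations preserve the bracket. A subtruss need not
  contain the neutral element of \<open>G\<close>, which is why \<open>G\<close> itself cannot be restricted.\<close>

lemma (in truss) truss_subtruss: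
  assumes S: "subtruss T S" and "e \<in> S"
  shows "truss (T\<lparr>carrier := S\<rparr>)"
proof -
  have sub: "x \<in> carrier T" if "x \<in> S" for x
    using S that unfolding subtruss_def by blast
  obtain G :: "'a monoid" where "comm_group G" and carr: "carrier G = carrier T"
    and br: "\<And>x y z. x \<in> carrier T \<Longrightarrow> y \<in> carrier T \<Longrightarrow> z \<in> carrier T
      \<Longrightarrow> bracket T x y z = x \<otimes>\<^bsub>G\<^esub> inv\<^bsub>G\<^esub> y \<otimes>\<^bsub>G\<^esub> z"
    using bracket_group by blast
  interpret G: comm_group G by fact
  have subG: "x \<in> carrier G" if "x \<in> S" for x
    using sub[OF that] carr by simp
  have cancel: "inv\<^bsub>G\<^esub> e \<otimes>\<^bsub>G\<^esub> (e \<otimes>\<^bsub>G\<^esub> x) = x" "e \<otimes>\<^bsub>G\<^esub> (inv\<^bsub>G\<^esub> e \<otimes>\<^bsub>G\<^esub> x) = x"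
    if "x \<in> carrier G" for x
    using that subG[OF \<open>e \<in> S\<close>] by (simp_all flip: G.m_assoc)
  define H where "H = \<lparr>carrier = S, monoid.mult = (\<lambda>x y. bracket T x e y), one = e\<rparr>"
  have Hmult: "x \<otimes>\<^bsub>H\<^esub> y = x \<otimes>\<^bsub>G\<^esub> inv\<^bsub>G\<^esub> e \<otimes>\<^bsub>G\<^esub> y" if "x \<in> S" "y \<in> S" for x y
    using that sub \<open>e \<in> S\<close> by (simp add: H_def br)
  have closed: "bracket T x y z \<in> S" if "x \<in> S" "y \<in> S" "z \<in> S" for x y z
    using that S unfolding subtruss_def by blast
  have Hclosed: "x \<otimes>\<^bsub>H\<^esub> y \<in> S" if "x \<in> S" "y \<in> S" for x y
    using that closed \<open>e \<in> S\<close> by (simp add: H_def)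
  have neg: "bracket T e x e = e \<otimes>\<^bsub>G\<^esub> inv\<^bsub>G\<^esub> x \<otimes>\<^bsub>G\<^esub> e" "bracket T e x e \<in> S" if "x \<in> S" for x
    using that sub br closed \<open>e \<in> S\<close> by auto
  have neg_l: "bracket T e x e \<otimes>\<^bsub>H\<^esub> x = e" if "x \<in> S" for x
    using that subG \<open>e \<in> S\<close> neg[OF that] by (simp add: Hmult G.m_assoc cancel)
  have H: "comm_group H"
  proof (rule comm_groupI)
    show "x \<otimes>\<^bsub>H\<^esub> y \<in> carrier H" if "x \<in> carrier H" "y \<in> carrier H" for x y
      using that Hclosed by (simp add: H_def)
    show "\<one>\<^bsub>H\<^esub> \<in> carrier H" using \<open>e \<in> S\<close> by (simp add: H_def)
    show "(x \<otimes>\<^bsub>H\<^esub> y) \<otimes>\<^bsub>H\<^esub> z = x \<otimes>\<^bsub>H\<^esub> (y \<otimes>\<^bsub>H\<^esub> z)"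
      if "x \<in> carrier H" "y \<in> carrier H" "z \<in> carrier H" for x y z
    proof -
      have "x \<in> S" "y \<in> S" "z \<in> S" using that by (simp_all add: H_def)
      moreover from this have "x \<otimes>\<^bsub>H\<^esub> y \<in> S" "y \<otimes>\<^bsub>H\<^esub> z \<in> S" by (simp_all add: Hclosed)
      ultimately show ?thesis
        using subG \<open>e \<in> S\<close> by (simp add: Hmult G.m_assoc)
    qed
    show "x \<otimes>\<^bsub>H\<^esub> y = y \<otimes>\<^bsub>H\<^esub> x" if "x \<in> carrier H" "y \<in> carrier H" for x y
    proof -
      have "x \<in> S" "y \<in> S" using that by (simp_all add: H_def)
      then show ?thesis using subG \<open>e \<in> S\<close> by (simp add: Hmult G.m_ac)
    qed
    show "\<one>\<^bsub>H\<^esub> \<otimes>\<^bsub>H\<^esub> x = x" if "x \<in> carrier H" for x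
    proof -
      have "x \<in> S" using that by (simp add: H_def)
      then have "e \<otimes>\<^bsub>H\<^esub> x = x" using subG \<open>e \<in> S\<close> by (simp add: Hmult)
      then show ?thesis by (simp add: H_def)
    qed
    show "\<exists>y\<in>carrier H. y \<otimes>\<^bsub>H\<^esub> x = \<one>\<^bsub>H\<^esub>" if "x \<in> carrier H" for x
      using that neg(2) neg_l by (intro bexI[of _ "bracket T e x e"]) (simp_all add: H_def)
  qed
  have inv: "inv\<^bsub>H\<^esub> y = bracket T e y e" if "y \<in> S" for y
    by (rule group.inv_equality[OF comm_group.axioms(2)[OF H]])
      (use that neg_l neg(2) in \<open>simp_all add: H_def\<close>)
  have bracket_H: "bracket T x y z = x \<otimes>\<^bsub>H\<^esub> inv\<^bsub>H\<^esub> y \<otimes>\<^bsub>H\<^esub> z" if "x \<in> S" "y \<in> S" "z \<in> S" for x y z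
    using that subG sub \<open>e \<in> S\<close> neg[OF that(2)] Hclosed[OF that(1) neg(2)[OF that(2)]]
    by (simp add: inv Hmult br G.m_assoc cancel)
  show ?thesis
  proof (unfold_locales, goal_cases)
    case 1
    show ?case using H bracket_H by (intro exI[of _ H]) (simp add: H_def)
  next
    case (2 x y)
    then show ?case using S by (simp add: subtruss_def)
  qed (use sub tmult_assoc distrib_left distrib_right in simp_all)
qed

context ring
begin

lemma braceable_subtruss_one_plus:
  assumes S: "nilpotent_subring_of_index R S 3"
  shows "braceable_subtruss (truss_of_ring R) (\<one> <+ S)"
proof -
  have add: "additive_subgroup S R" and mult: "\<And>x y. x \<in> S \<Longrightarrow> y \<in> S \<Longrightarrow> x \<otimes> y \<in> S"
    and cube: "\<And>x y z. x \<in> S \<Longrightarrow> y \<in> S \<Longrightarrow> z \<in> S \<Longrightarrow> x \<otimes> y \<otimes> z = \<zero>"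
    using S unfolding nilpotent_subring_of_index_3_iff nonunital_subring_def by blast+
  have sub: "x \<in> carrier R" if "x \<in> S" for x
    using additive_subgroup.a_subset[OF add] that by blast
  have plus: "x \<oplus> y \<in> S" if "x \<in> S" "y \<in> S" for x y
    using additive_subgroup.a_closed[OF add] that by blast
  have neg: "\<ominus> x \<in> S" if "x \<in> S" for x
    using add that by (rule additive_subgroup.a_inv_closed)
  define K where "K = \<one> <+ S"
  have K: "\<one> \<oplus> x \<in> K" if "x \<in> S" for x
    using that by (auto simp: K_def a_l_coset_def')
  have KE: "\<exists>x\<in>S. k = \<one> \<oplus> x" if "k \<in> K" for k
    using that by (auto simp: K_def a_l_coset_def')
  have one: "\<one> \<in> K"
    using K[of \<zero>] additive_subgroup.zero_closed[OF add] by simp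
  have sub_K: "k \<in> carrier R" if "k \<in> K" for k
    using KE[OF that] sub by auto
  have mult_K: "k \<otimes> l \<in> K" if kl: "k \<in> K" "l \<in> K" for k l
  proof -
    obtain x y where xy: "k = \<one> \<oplus> x" "l = \<one> \<oplus> y" "x \<in> S" "y \<in> S"
      using kl KE by meson
    then have "k \<otimes> l = \<one> \<oplus> (y \<oplus> (x \<oplus> x \<otimes> y))"
      using sub by (simp add: l_distr r_distr a_ac)
    then show ?thesis using xy by (simp add: K plus mult)
  qed
  have bracket_K: "k \<ominus> l \<oplus> m \<in> K" if klm: "k \<in> K" "l \<in> K" "m \<in> K" for k l m
  proof -
    obtain x y z where xyz: "k = \<one> \<oplus> x" "l = \<one> \<oplus> y" "m = \<one> \<oplus> z" "x \<in> S" "y \<in> S" "z \<in> S"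
      using klm KE by meson
    have cancel: "\<one> \<oplus> (u \<oplus> \<ominus> \<one>) = u" if "u \<in> carrier R" for u
      using that by (simp add: a_comm[of u] r_neg2)
    have "k \<ominus> l \<oplus> m = \<one> \<oplus> (x \<oplus> (\<ominus> y \<oplus> z))"
      using sub xyz by (simp add: a_minus_def minus_add a_ac r_neg1 r_neg2 cancel)
    then show ?thesis using xyz by (simp add: K plus neg)
  qed
  have inv_K: "\<exists>l\<in>K. l \<otimes> k = \<one>" if k: "k \<in> K" for k
  proof -
    obtain x where x: "k = \<one> \<oplus> x" "x \<in> S" using KE[OF k] by blast
    have xc: "x \<in> carrier R" using sub x by blast
    \<comment> \<open>The geometric series \<open>1 - x + x\<^sup>2\<close> for the inverse of \<open>1 + x\<close> stops there, as \<open>x\<^sup>3 = 0\<close>.\<close>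
    have "(\<one> \<oplus> (\<ominus> x \<oplus> x \<otimes> x)) \<otimes> k = \<one> \<oplus> (x \<oplus> (\<ominus> x \<oplus> (\<ominus> (x \<otimes> x) \<oplus> (x \<otimes> x \<oplus> x \<otimes> x \<otimes> x))))"
      using xc unfolding x(1) by (simp add: l_distr r_distr l_minus a_ac)
    also have "\<dots> = \<one>"
      using xc cube[OF x(2) x(2) x(2)] by (simp add: r_neg1 r_neg2 l_neg r_neg)
    finally show ?thesis
      using x K[of "\<ominus> x \<oplus> x \<otimes> x"] plus neg mult by blast
  qed
  have sub: "subtruss (truss_of_ring R) K"
    using sub_K mult_K bracket_K by (auto simp: subtruss_def truss_of_ring_def)
  moreover have "truss ((truss_of_ring R)\<lparr>carrier := K\<rparr>)"
    using truss.truss_subtruss[OF truss_truss_of_ring sub one] ring_axioms by blast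
  moreover have "group \<lparr>carrier = K, monoid.mult = (\<otimes>), one = \<one>\<rparr>"
    using sub_K mult_K one inv_K by (intro groupI) (auto simp: m_assoc)
  ultimately show ?thesis
    unfolding braceable_subtruss_def braceable_def K_def[symmetric]
    by (auto simp: truss_of_ring_def)
qed

lemma bracket_set_one_plus:
  assumes "additive_subgroup S1 R" "additive_subgroup S2 R" "additive_subgroup S3 R"
    and sum: "carrier R = S1 <+>\<^bsub>R\<^esub> S2 <+>\<^bsub>R\<^esub> S3"
  shows "carrier R = bracket_set (truss_of_ring R) (\<one> <+ S1) (\<one> <+ S2) (\<one> <+ S3)"
proof
  have sub: "S1 \<subseteq> carrier R" "S2 \<subseteq> carrier R" "S3 \<subseteq> carrier R"
    using assms(1-3) additive_subgroup.a_subset by blast+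
  then show "bracket_set (truss_of_ring R) (\<one> <+ S1) (\<one> <+ S2) (\<one> <+ S3) \<subseteq> carrier R"
    by (auto simp: bracket_set_def truss_of_ring_def a_l_coset_def' subset_iff)
  show "carrier R \<subseteq> bracket_set (truss_of_ring R) (\<one> <+ S1) (\<one> <+ S2) (\<one> <+ S3)"
  proof
    fix a assume a: "a \<in> carrier R"
    then have "a \<ominus> \<one> \<in> S1 <+>\<^bsub>R\<^esub> S2 <+>\<^bsub>R\<^esub> S3" using sum by auto
    then obtain x y z where xyz: "x \<in> S1" "y \<in> S2" "z \<in> S3" and eq: "a \<ominus> \<one> = x \<oplus> y \<oplus> z"
      by (auto simp: set_add_def')
    have c: "x \<in> carrier R" "y \<in> carrier R" "z \<in> carrier R" using xyz sub by auto
    have "\<ominus> y \<in> S2" using assms(2) xyz(2) by (rule additive_subgroup.a_inv_closed)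
    \<comment> \<open>The middle argument of the bracket is subtracted, hence \<open>1 - y\<close> is used there.\<close>
    have "a = \<one> \<oplus> (a \<ominus> \<one>)" using a by (simp add: a_minus_def a_ac r_neg1 r_neg2 l_neg r_neg)
    also have "\<dots> = (\<one> \<oplus> x) \<ominus> (\<one> \<oplus> \<ominus> y) \<oplus> (\<one> \<oplus> z)"
      unfolding eq using c by (simp add: a_minus_def minus_add a_ac r_neg r_neg1 r_neg2)
    finally show "a \<in> bracket_set (truss_of_ring R) (\<one> <+ S1) (\<one> <+ S2) (\<one> <+ S3)"
      using xyz \<open>\<ominus> y \<in> S2\<close>
      unfolding bracket_set_def truss_of_ring_def a_l_coset_def' by auto
  qed
qed

end


section \<open>Three by three matrices\<close>

definition mat3 :: "'a \<Rightarrow> 'a \<Rightarrow> 'a \<Rightarrow> 'a \<Rightarrow> 'a \<Rightarrow> 'a \<Rightarrow> 'a \<Rightarrow> 'a \<Rightarrow> 'a \<Rightarrow> 'a mat" where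
  "mat3 a b c d e f g h i = mat 3 3 (\<lambda>(m, n). [[a, b, c], [d, e, f], [g, h, i]] ! m ! n)"

lemma less_3_cases: "(i::nat) < 3 \<longleftrightarrow> i = 0 \<or> i = 1 \<or> i = 2"
  by auto

lemma less_3_set: "{0..<3::nat} = {0, 1, 2}"
  by auto

lemma mat3_carrier: "mat3 a b c d e f g h i \<in> carrier_mat 3 3"
  by (simp add: mat3_def)

lemma mat3_eta:
  assumes "A \<in> carrier_mat 3 3"
  shows "A = mat3 (A $$ (0,0)) (A $$ (0,1)) (A $$ (0,2)) (A $$ (1,0)) (A $$ (1,1)) (A $$ (1,2))
    (A $$ (2,0)) (A $$ (2,1)) (A $$ (2,2))"
  using assms by (intro eq_matI) (auto simp: mat3_def less_3_cases)

lemma mat3_eq_iff: "mat3 a b c d e f g h i = mat3 a' b' c' d' e' f' g' h' i' \<longleftrightarrow>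
  a = a' \<and> b = b' \<and> c = c' \<and> d = d' \<and> e = e' \<and> f = f' \<and> g = g' \<and> h = h' \<and> i = i'" (is "?A = ?B \<longleftrightarrow> _")
proof
  assume "?A = ?B"
  then have "?A $$ (m, n) = ?B $$ (m, n)" for m n by simp
  from this[of 0 0] this[of 0 1] this[of 0 2] this[of 1 0] this[of 1 1] this[of 1 2]
    this[of 2 0] this[of 2 1] this[of 2 2]
  show "a = a' \<and> b = b' \<and> c = c' \<and> d = d' \<and> e = e' \<and> f = f' \<and> g = g' \<and> h = h' \<and> i = i'"
    by (simp add: mat3_def)
qed simp

lemma mat3_add: "mat3 a b c d e f g h i + mat3 a' b' c' d' e' f' g' h' i' =
  mat3 (a + a') (b + b') (c + c') (d + d') (e + e') (f + f') (g + g') (h + h') (i + i')"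
  by (intro eq_matI) (auto simp: mat3_def less_3_cases)

lemma mat3_mult: "mat3 a b c d e f g h i * mat3 a' b' c' d' e' f' g' h' i' =
  mat3 (a * a' + b * d' + c * g') (a * b' + b * e' + c * h') (a * c' + b * f' + c * i')
    (d * a' + e * d' + f * g') (d * b' + e * e' + f * h') (d * c' + e * f' + f * i')
    (g * a' + h * d' + i * g') (g * b' + h * e' + i * h') (g * c' + h * f' + i * i')"
  by (intro eq_matI)
    (auto simp: mat3_def less_3_cases scalar_prod_def less_3_set add.assoc)

lemma mat3_zero: "0\<^sub>m 3 3 = mat3 0 0 0 0 0 0 0 0 0"
  by (intro eq_matI) (auto simp: mat3_def less_3_cases)

lemma mat3_one: "1\<^sub>m 3 = mat3 1 0 0 0 1 0 0 0 1"
  by (intro eq_matI) (auto simp: mat3_def less_3_cases)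

lemmas mat3_ring_simps = mat3_add mat3_mult mat3_zero mat3_one mat3_eq_iff


section \<open>Decomposition of the matrix ring\<close>

definition strict_upper3 :: "'a::zero mat set" where
  "strict_upper3 = {mat3 0 x y 0 0 z 0 0 0 | x y z. True}"

lemma strict_upper3_nilpotent:
  "nilpotent_subring_of_index (ring_mat TYPE('a::ring_1) 3 ()) strict_upper3 3"
proof -
  interpret R: ring "ring_mat TYPE('a) 3 ()" by (rule ring_mat_noncomm)
  have "additive_subgroup strict_upper3 (ring_mat TYPE('a) 3 ())"
  proof (intro additive_subgroupI subgroup.intro)
    show "(strict_upper3 :: 'a mat set) \<subseteq> carrier (add_monoid (ring_mat TYPE('a) 3 ()))"
      by (auto simp: strict_upper3_def ring_mat_simps mat3_carrier)
    show "\<one>\<^bsub>add_monoid (ring_mat TYPE('a) 3 ())\<^esub> \<in> strict_upper3"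
      by (auto simp: strict_upper3_def ring_mat_simps mat3_zero)
  next
    fix A B :: "'a mat" assume "A \<in> strict_upper3" "B \<in> strict_upper3"
    then show "A \<otimes>\<^bsub>add_monoid (ring_mat TYPE('a) 3 ())\<^esub> B \<in> strict_upper3"
      by (auto simp: strict_upper3_def ring_mat_simps mat3_ring_simps)
  next
    fix A :: "'a mat" assume "A \<in> strict_upper3"
    then obtain x y z where A: "A = mat3 0 x y 0 0 z 0 0 0" by (auto simp: strict_upper3_def)
    have "inv\<^bsub>add_monoid (ring_mat TYPE('a) 3 ())\<^esub> A = mat3 0 (-x) (-y) 0 0 (-z) 0 0 0"
      unfolding A by (rule group.inv_equality[OF R.a_group])
        (simp_all add: ring_mat_simps mat3_ring_simps mat3_carrier)
    then show "inv\<^bsub>add_monoid (ring_mat TYPE('a) 3 ())\<^esub> A \<in> strict_upper3"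
      by (auto simp: strict_upper3_def)
  qed
  moreover have "\<exists>A\<in>strict_upper3. \<exists>B\<in>strict_upper3. A * B \<noteq> (0\<^sub>m 3 3 :: 'a mat)"
  proof (intro bexI)
    show "mat3 0 1 0 0 0 0 0 0 0 * mat3 0 0 0 0 0 1 0 0 0 \<noteq> (0\<^sub>m 3 3 :: 'a mat)"
      by (simp add: mat3_ring_simps)
  qed (auto simp: strict_upper3_def)
  ultimately show ?thesis
    unfolding R.nilpotent_subring_of_index_3_iff nonunital_subring_def
    by (auto simp: strict_upper3_def ring_mat_simps mat3_ring_simps)
qed

text \<open>The matrix \<open>h\<close> is the inverse of \<open>g\<close>, and conjugation by \<open>w\<close> reverses the order of rows and columns
  and so turns upper into lower triangular matrices.\<close>

lemma mat3_eq_sum_of_conjugates: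
  fixes r :: "'a::ring_1"
  assumes r: "surj (inner_derivation r)"
  defines "w \<equiv> mat3 0 0 1 0 1 0 1 0 0"
    and "g \<equiv> mat3 1 0 0 1 1 0 r 1 1"
    and "h \<equiv> mat3 1 0 0 (-1) 1 0 (1 - r) (-1) 1"
  assumes A: "A \<in> carrier_mat 3 3"
  shows "\<exists>k\<in>strict_upper3. \<exists>l\<in>strict_upper3. \<exists>n\<in>strict_upper3. A = k + w * l * w + g * n * h"
proof -
  obtain a b c d e f p q s where A_eq: "A = mat3 a b c d e f p q s"
    using mat3_eta[OF A] by blast
  obtain y where "a + e + s = inner_derivation r y"
    using r by (meson surjD)
  then have y: "a + e + s = r * y - y * r" by (simp add: inner_derivation_def)
  \<comment> \<open>The choice of \<open>y\<close> corrects the trace; \<open>x\<close> and \<open>z\<close> solve \<open>y (1 - r) - x = a\<close> and \<open>r y + z = s\<close>.\<close>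
  define x z where "x = y * (1 - r) - a" and "z = s - r * y"
  have e: "e = r * y - y * r - a - s" using y by (simp add: algebra_simps eq_diff_eq)
  define N where "N = g * mat3 0 x y 0 0 z 0 0 0 * h"
  have N: "N = mat3 a (x - y) y (a + z * (1 - r)) e (y + z) (r * a + z * (1 - r)) (r * (x - y) - z) s"
    unfolding N_def g_def h_def e
    by (simp add: mat3_ring_simps x_def z_def algebra_simps)
  \<comment> \<open>What remains has zero diagonal and splits into its upper and lower parts.\<close>
  let ?k = "mat3 0 (b - (x - y)) (c - y) 0 0 (f - (y + z)) 0 0 0"
  let ?l = "mat3 0 (q - (r * (x - y) - z)) (p - (r * a + z * (1 - r))) 0 0 (d - (a + z * (1 - r))) 0 0 0"
  have "A = ?k + w * ?l * w + N"
    unfolding A_eq N w_def by (simp add: mat3_ring_simps)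
  then show ?thesis unfolding N_def strict_upper3_def by blast
qed

theorem proposition3p5:
  assumes "\<exists>r :: 'a::ring_1. surj (inner_derivation r)"
  shows "(\<exists>S1 S2 S3.
            nilpotent_subring_of_index (ring_mat TYPE('a) 3 ()) S1 3 \<and>
            nilpotent_subring_of_index (ring_mat TYPE('a) 3 ()) S2 3 \<and>
            nilpotent_subring_of_index (ring_mat TYPE('a) 3 ()) S3 3 \<and>
            carrier (ring_mat TYPE('a) 3 ()) =
              S1 <+>\<^bsub>ring_mat TYPE('a) 3 ()\<^esub> S2 <+>\<^bsub>ring_mat TYPE('a) 3 ()\<^esub> S3) \<and>
         (\<exists>K L M.
            braceable_subtruss (truss_of_ring (ring_mat TYPE('a) 3 ())) K \<and>
            braceable_subtruss (truss_of_ring (ring_mat TYPE('a) 3 ())) L \<and>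
            braceable_subtruss (truss_of_ring (ring_mat TYPE('a) 3 ())) M \<and>
            carrier (ring_mat TYPE('a) 3 ()) =
              bracket_set (truss_of_ring (ring_mat TYPE('a) 3 ())) K L M)"
proof -
  let ?Q = "ring_mat TYPE('a) 3 ()"
  interpret Q: ring ?Q by (rule ring_mat_noncomm)
  obtain r :: 'a where r: "surj (inner_derivation r)" using assms by blast
  define w :: "'a mat" where "w = mat3 0 0 1 0 1 0 1 0 0"
  define g :: "'a mat" where "g = mat3 1 0 0 1 1 0 r 1 1"
  define h :: "'a mat" where "h = mat3 1 0 0 (-1) 1 0 (1 - r) (-1) 1"
  define S1 S2 S3 where "S1 = (strict_upper3 :: 'a mat set)"
    and "S2 = (\<lambda>n. w * n * w) ` S1" and "S3 = (\<lambda>n. g * n * h) ` S1"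
  have "w * w = 1\<^sub>m 3" "g * h = 1\<^sub>m 3" "h * g = 1\<^sub>m 3"
    by (simp_all add: w_def g_def h_def mat3_ring_simps)
  moreover have "w \<in> carrier_mat 3 3" "g \<in> carrier_mat 3 3" "h \<in> carrier_mat 3 3"
    by (simp_all add: w_def g_def h_def mat3_carrier)
  moreover have S1: "nilpotent_subring_of_index ?Q S1 3"
    unfolding S1_def by (rule strict_upper3_nilpotent)
  ultimately have S2: "nilpotent_subring_of_index ?Q S2 3" and S3: "nilpotent_subring_of_index ?Q S3 3"
    using Q.nilpotent_subring_of_index_3_conjugate[OF S1, of w w]
      Q.nilpotent_subring_of_index_3_conjugate[OF S1, of g h]
    by (simp_all add: ring_mat_simps S2_def S3_def)
  have add: "additive_subgroup S1 ?Q" "additive_subgroup S2 ?Q" "additive_subgroup S3 ?Q"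
    using S1 S2 S3 by (simp_all add: nilpotent_subring_of_index_def nonunital_subring_def)
  have sum: "carrier ?Q = S1 <+>\<^bsub>?Q\<^esub> S2 <+>\<^bsub>?Q\<^esub> S3"
  proof
    show "S1 <+>\<^bsub>?Q\<^esub> S2 <+>\<^bsub>?Q\<^esub> S3 \<subseteq> carrier ?Q"
      using add[THEN additive_subgroup.a_subset] by (intro Q.set_add_closed)
    show "carrier ?Q \<subseteq> S1 <+>\<^bsub>?Q\<^esub> S2 <+>\<^bsub>?Q\<^esub> S3"
    proof
      fix A assume "A \<in> carrier ?Q"
      then have "A \<in> carrier_mat 3 3" by (simp add: ring_mat_simps)
      then show "A \<in> S1 <+>\<^bsub>?Q\<^esub> S2 <+>\<^bsub>?Q\<^esub> S3"
        using mat3_eq_sum_of_conjugates[OF r, of A]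
        by (auto simp: set_add_def' ring_mat_simps S1_def S2_def S3_def w_def g_def h_def)
    qed
  qed
  show ?thesis
    using S1 S2 S3 sum Q.braceable_subtruss_one_plus[OF S1] Q.braceable_subtruss_one_plus[OF S2]
      Q.braceable_subtruss_one_plus[OF S3] Q.bracket_set_one_plus[OF add sum]
    by blast
qed

end
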